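(* An ascent sequence avoids the pattern $101$ if and only if it avoids the pattern $0101$. For every $n\ge1$, the number of ascent sequences of length $n$ avoiding $101$ equals the Catalan number $C_n=\frac{1}{n+1}\binom{2n}{n}$. Moreover, the number of ascents on these sequences has the Narayana distribution: for $0\le k\le n-1$, the number of $101$-avoiding ascent sequences of length $n$ with exactly $k$ ascents is $N(n,k+1)=\frac1n\binom{n}{k+1}\binom{n}{k}$.
   Context: An ascent sequence is a finite sequence $x_1x_2\ldots x_n$ of nonnegative integers with $x_1=0$ and $x_i\le \operatorname{asc}(x_1\ldots x_{i-1})+1$ for all $1<i\le n$, where $\operatorname{asc}(y_1\ldots y_k)$ is the number of indices $j$ with $y_j<y_{j+1}$ (ascents). A pattern is a finite word over the nonnegative integers. An occurrence of a pattern $p=p_1\ldots p_k$ in a sequence $x_1\ldots x_n$ is a subsequence $x_{i_1}\ldots x_{i_k}$, $i_1<\cdots<i_k$, such that for all $a,b$: $x_{i_a}<x_{i_b}$ iff $p_a<p_b$ and $x_{i_a}=x_{i_b}$ iff $p_a=p_b$. A sequence avoids $p$ if it has no occurrence of $p$. The Narayana numbers are $N(n,k)=\frac1n\binom{n}{k}\binom{n}{k-1}$. *)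

theory Defs
  imports Complex_Main
begin

definition asc :: "nat list \<Rightarrow> nat" where
  "asc ys = card {j. Suc j < length ys \<and> ys ! j < ys ! Suc j}"

text \<open>
  Lists are indexed from 0, so the prefix preceding the entry \<open>xs ! i\<close> is \<open>take i xs\<close>.
  The condition on the first entry presupposes that there is one: the empty list is not
  an ascent sequence.
\<close>

definition ascent_sequence :: "nat list \<Rightarrow> bool" where
  "ascent_sequence xs \<longleftrightarrow>
     xs \<noteq> [] \<and> xs ! 0 = 0 \<and>
     (\<forall>i. 0 < i \<and> i < length xs \<longrightarrow> xs ! i \<le> asc (take i xs) + 1)"

text \<open>The function \<open>f\<close> lists the positions \<open>i\<^sub>1 < \<dots> < i\<^sub>k\<close> of the subsequence.\<close>

definition occurrence :: "nat list \<Rightarrow> nat list \<Rightarrow> (nat \<Rightarrow> nat) \<Rightarrow> bool" where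
  "occurrence p xs f \<longleftrightarrow>
     strict_mono_on {..<length p} f \<and>
     (\<forall>a<length p. f a < length xs) \<and>
     (\<forall>a<length p. \<forall>b<length p.
        (xs ! f a < xs ! f b \<longleftrightarrow> p ! a < p ! b) \<and>
        (xs ! f a = xs ! f b \<longleftrightarrow> p ! a = p ! b))"

definition avoids :: "nat list \<Rightarrow> nat list \<Rightarrow> bool" where
  "avoids xs p \<longleftrightarrow> (\<nexists>f. occurrence p xs f)"

definition catalan :: "nat \<Rightarrow> real" where
  "catalan n = 1 / real (n + 1) * real ((2 * n) choose n)"

text \<open>Only meaningful for \<open>n, k \<ge> 1\<close>, since \<open>k - 1\<close> is truncated and \<open>1 / 0 = 0\<close>.\<close>

definition narayana :: "nat \<Rightarrow> nat \<Rightarrow> real" where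
  "narayana n k = 1 / real n * real (n choose k) * real (n choose (k - 1))"

end

theory Submission
  imports Defs
begin

text \<open>
  A 101-avoiding ascent sequence is a restricted growth word in which every ascent goes to a new
  maximum. It can be extended by a new maximum or by an active value, that is, one not yet
  followed by a smaller entry. Repeating an active value deactivates exactly the larger ones.
  So the number of active values performs a walk whose up steps are the ascents, and the walks
  with given numbers of steps and up steps are counted by a difference of two products of binomial
  coefficients, which gives the Narayana numbers. Vandermonde's identity sums them to the
  Catalan number.
\<close>

text \<open>Otherwise simp turns the pattern \<open>[1, 0, 1]\<close> into \<open>[Suc 0, 0, Suc 0]\<close>.\<close>

declare One_nat_def [simp del]

section \<open>Occurrences of 101 and 0101 in terms of positions\<close>

text \<open>One strict inequality and one equality already determine the order type 101; the other
  comparisons follow.\<close>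

lemma avoids_101_iff:
  "avoids xs [1, 0, 1] \<longleftrightarrow>
    (\<forall>i j k. i < j \<longrightarrow> j < k \<longrightarrow> k < length xs \<longrightarrow> xs ! j < xs ! i \<longrightarrow> xs ! k \<noteq> xs ! i)"
proof
  assume av: "avoids xs [1, 0, 1]"
  show "\<forall>i j k. i < j \<longrightarrow> j < k \<longrightarrow> k < length xs \<longrightarrow> xs ! j < xs ! i \<longrightarrow> xs ! k \<noteq> xs ! i"
  proof (intro allI impI notI)
    fix i j k assume "i < j" "j < k" "k < length xs" "xs ! j < xs ! i" "xs ! k = xs ! i"
    then have "occurrence [1, 0, 1] xs ((!) [i, j, k])"
      by (auto simp: occurrence_def strict_mono_on_def numeral_3_eq_3 One_nat_def less_Suc_eq)
    then show False using av by (auto simp: avoids_def)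
  qed
next
  assume *: "\<forall>i j k. i < j \<longrightarrow> j < k \<longrightarrow> k < length xs \<longrightarrow> xs ! j < xs ! i \<longrightarrow> xs ! k \<noteq> xs ! i"
  show "avoids xs [1, 0, 1]"
    unfolding avoids_def
  proof
    assume "\<exists>f. occurrence [1, 0, 1] xs f"
    then obtain f where f: "occurrence [1, 0, 1] xs f" by blast
    have mono: "f a < f b" if "a < b" "b < 3" for a b
      using f that by (auto simp: occurrence_def strict_mono_on_def)
    have order: "xs ! f a < xs ! f b \<longleftrightarrow> [1, 0, 1] ! a < ([1, 0, 1] ! b :: nat)"
      "xs ! f a = xs ! f b \<longleftrightarrow> [1, 0, 1] ! a = ([1, 0, 1] ! b :: nat)" if "a < 3" "b < 3" for a b
      using f that by (simp_all add: occurrence_def)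
    have "f 0 < f 1" "f 1 < f 2" "f 2 < length xs"
      using mono[of 0 1] mono[of 1 2] f by (simp_all add: occurrence_def)
    moreover have "xs ! f 1 < xs ! f 0" "xs ! f 2 = xs ! f 0"
      using order(1)[of 1 0] order(2)[of 2 0] by simp_all
    ultimately show False using * by blast
  qed
qed

lemma avoids_0101_iff:
  "avoids xs [0, 1, 0, 1] \<longleftrightarrow>
    (\<forall>h i j k. h < i \<longrightarrow> i < j \<longrightarrow> j < k \<longrightarrow> k < length xs \<longrightarrow> xs ! h < xs ! i \<longrightarrow>
      xs ! j = xs ! h \<longrightarrow> xs ! k \<noteq> xs ! i)"
proof
  assume av: "avoids xs [0, 1, 0, 1]"
  show "\<forall>h i j k. h < i \<longrightarrow> i < j \<longrightarrow> j < k \<longrightarrow> k < length xs \<longrightarrow> xs ! h < xs ! i \<longrightarrow>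
      xs ! j = xs ! h \<longrightarrow> xs ! k \<noteq> xs ! i"
  proof (intro allI impI notI)
    fix h i j k assume "h < i" "i < j" "j < k" "k < length xs" "xs ! h < xs ! i"
      "xs ! j = xs ! h" "xs ! k = xs ! i"
    then have "occurrence [0, 1, 0, 1] xs ((!) [h, i, j, k])"
      by (auto simp: occurrence_def strict_mono_on_def numeral_3_eq_3 One_nat_def less_Suc_eq)
    then show False using av by (auto simp: avoids_def)
  qed
next
  assume *: "\<forall>h i j k. h < i \<longrightarrow> i < j \<longrightarrow> j < k \<longrightarrow> k < length xs \<longrightarrow> xs ! h < xs ! i \<longrightarrow>
      xs ! j = xs ! h \<longrightarrow> xs ! k \<noteq> xs ! i"
  show "avoids xs [0, 1, 0, 1]"
    unfolding avoids_def
  proof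
    assume "\<exists>f. occurrence [0, 1, 0, 1] xs f"
    then obtain f where f: "occurrence [0, 1, 0, 1] xs f" by blast
    have mono: "f a < f b" if "a < b" "b < 4" for a b
      using f that by (auto simp: occurrence_def strict_mono_on_def)
    have order: "xs ! f a < xs ! f b \<longleftrightarrow> [0, 1, 0, 1] ! a < ([0, 1, 0, 1] ! b :: nat)"
      "xs ! f a = xs ! f b \<longleftrightarrow> [0, 1, 0, 1] ! a = ([0, 1, 0, 1] ! b :: nat)"
      if "a < 4" "b < 4" for a b
      using f that by (simp_all add: occurrence_def)
    have "f 0 < f 1" "f 1 < f 2" "f 2 < f 3" "f 3 < length xs"
      using mono[of 0 1] mono[of 1 2] mono[of 2 3] f by (simp_all add: occurrence_def)
    moreover have "xs ! f 0 < xs ! f 1" "xs ! f 2 = xs ! f 0" "xs ! f 3 = xs ! f 1"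
      using order(1)[of 0 1] order(2)[of 2 0] order(2)[of 3 1] by simp_all
    ultimately show False using * by blast
  qed
qed

section \<open>Ascents and ascent sequences under appending an entry\<close>

lemma asc_snoc:
  assumes "p \<noteq> []"
  shows "asc (p @ [v]) = asc p + (if last p < v then 1 else 0)"
proof -
  let ?A = "{j. Suc j < length p \<and> p ! j < p ! Suc j}"
  have len: "Suc (length p - 1) = length p" using assms by (cases p) auto
  have "{j. Suc j < length (p @ [v]) \<and> (p @ [v]) ! j < (p @ [v]) ! Suc j}
      = ?A \<union> (if last p < v then {length p - 1} else {})"
  proof (intro set_eqI)
    fix j
    consider "Suc j < length p" | "Suc j = length p" | "length p < Suc j" by linarith
    then show "j \<in> {j. Suc j < length (p @ [v]) \<and> (p @ [v]) ! j < (p @ [v]) ! Suc j}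
        \<longleftrightarrow> j \<in> ?A \<union> (if last p < v then {length p - 1} else {})"
    proof cases
      case 2
      then have "j = length p - 1" by simp
      then show ?thesis using 2 assms by (simp add: nth_append last_conv_nth)
    qed (use len in \<open>auto simp: nth_append\<close>)
  qed
  moreover have "finite ?A" by (rule finite_subset[of _ "{..<length p}"]) auto
  moreover have "length p - 1 \<notin> ?A" using len by simp
  ultimately show ?thesis by (simp add: asc_def)
qed

lemma asc_singleton [simp]: "asc [v] = 0"
  by (simp add: asc_def)

lemma asc_append_ge: "p \<noteq> [] \<Longrightarrow> asc p \<le> asc (p @ ys)"
proof (induction ys rule: rev_induct)
  case (snoc v ys)
  then show ?case using asc_snoc[of "p @ ys" v] by simp
qed simp

lemma asc_less_length:
  assumes "xs \<noteq> []"
  shows "asc xs < length xs"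
proof -
  have "asc xs \<le> card {..<length xs - 1}"
    unfolding asc_def by (rule card_mono) auto
  then show ?thesis using assms by (cases xs) auto
qed

lemma ascent_sequence_singleton: "ascent_sequence [v] \<longleftrightarrow> v = 0"
  by (auto simp: ascent_sequence_def)

lemma ascent_sequence_snoc:
  assumes "p \<noteq> []"
  shows "ascent_sequence (p @ [v]) \<longleftrightarrow> ascent_sequence p \<and> v \<le> asc p + 1"
proof -
  have "(\<forall>i. 0 < i \<and> i < Suc (length p) \<longrightarrow> Q i) \<longleftrightarrow> Q (length p) \<and> (\<forall>i. 0 < i \<and> i < length p \<longrightarrow> Q i)"
    for Q using assms by (auto simp: less_Suc_eq)
  then show ?thesis using assms
    by (auto simp: ascent_sequence_def nth_append)
qed

section \<open>Active values\<close>

text \<open>The values that can be repeated without creating an occurrence of 101.\<close>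

definition active :: "nat list \<Rightarrow> nat set" where
  "active p = {v \<in> set p. \<forall>i j. i < j \<longrightarrow> j < length p \<longrightarrow> p ! i = v \<longrightarrow> v \<le> p ! j}"

lemma finite_active [simp]: "finite (active p)"
  by (simp add: active_def)

lemma active_singleton [simp]: "active [v] = {v}"
  by (auto simp: active_def)

lemma active_subset: "active p \<subseteq> set p"
  by (auto simp: active_def)

lemma active_le_last:
  assumes "v \<in> active p"
  shows "v \<le> last p"
proof -
  obtain i where i: "i < length p" "p ! i = v"
    using assms by (auto simp: active_def in_set_conv_nth)
  then have p: "last p = p ! (length p - 1)" by (intro last_conv_nth) auto
  show ?thesis
  proof (cases "i = length p - 1")
    case False
    then have "i < length p - 1" using i by linarith
    then show ?thesis using i p assms unfolding active_def by auto
  qed (use i p in auto)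
qed

text \<open>A smaller entry after an earlier copy of the last value would form 101 together with
  that copy and the last entry.\<close>

lemma last_in_active:
  assumes "p \<noteq> []" "avoids p [1, 0, 1]"
  shows "last p \<in> active p"
  unfolding active_def
proof (intro CollectI conjI allI impI)
  fix i j assume ij: "i < j" "j < length p" "p ! i = last p"
  show "last p \<le> p ! j"
  proof (rule ccontr)
    assume "\<not> last p \<le> p ! j"
    moreover from this have "j \<noteq> length p - 1" using assms by (auto simp: last_conv_nth)
    then have "j < length p - 1" using ij by linarith
    ultimately show False
      using ij assms(2)[unfolded avoids_101_iff, rule_format, of i j "length p - 1"] assms(1)
      by (auto simp: last_conv_nth)
  qed
qed (use assms in auto)

text \<open>A new occurrence must use \<open>v\<close> as its final 1, so some earlier copy of
  \<open>v\<close> has already been followed by a smaller entry.\<close>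

lemma avoids_101_snoc:
  "avoids (p @ [v]) [1, 0, 1] \<longleftrightarrow> avoids p [1, 0, 1] \<and> (v \<in> set p \<longrightarrow> v \<in> active p)"
proof -
  have "avoids (p @ [v]) [1, 0, 1] \<longleftrightarrow> avoids p [1, 0, 1] \<and>
      (\<forall>i j. i < j \<longrightarrow> j < length p \<longrightarrow> p ! j < p ! i \<longrightarrow> v \<noteq> p ! i)" (is "?L \<longleftrightarrow> ?R")
  proof
    assume L: ?L
    have "p ! k \<noteq> p ! i" if "i < j" "j < k" "k < length p" "p ! j < p ! i" for i j k
      using L[unfolded avoids_101_iff, rule_format, of i j k] that by (simp add: nth_append)
    moreover have "v \<noteq> p ! i" if "i < j" "j < length p" "p ! j < p ! i" for i j
      using L[unfolded avoids_101_iff, rule_format, of i j "length p"] that by (simp add: nth_append)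
    ultimately show ?R by (auto simp: avoids_101_iff)
  next
    assume ?R
    then show ?L by (auto simp: avoids_101_iff nth_append less_Suc_eq)
  qed
  also have "\<dots> \<longleftrightarrow> avoids p [1, 0, 1] \<and> (v \<in> set p \<longrightarrow> v \<in> active p)"
  proof -
    have "v \<in> set p" if "i < j" "j < length p" "p ! i = v" for i j
      using that by auto
    then have "(v \<in> set p \<longrightarrow> v \<in> active p)
        \<longleftrightarrow> (\<forall>i j. i < j \<longrightarrow> j < length p \<longrightarrow> p ! i = v \<longrightarrow> v \<le> p ! j)"
      unfolding active_def by blast
    then show ?thesis by (metis not_less)
  qed
  finally show ?thesis .
qed

text \<open>The new entry follows every old one, so it deactivates exactly the values above it. A
  first copy of \<open>v\<close> has nothing after it; for a repeated \<open>v\<close> the earlier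
  copies decide.\<close>

lemma active_snoc:
  "active (p @ [v]) = {u \<in> active p. u \<le> v} \<union> (if v \<in> set p then {} else {v})"
proof (intro set_eqI)
  fix u
  have split: "(\<forall>j. i < j \<longrightarrow> j < length (p @ [v]) \<longrightarrow> Q j)
      \<longleftrightarrow> (i < length p \<longrightarrow> Q (length p)) \<and> (\<forall>j. i < j \<longrightarrow> j < length p \<longrightarrow> Q j)" for i Q
    by (auto simp: less_Suc_eq)
  have "u \<in> active (p @ [v]) \<longleftrightarrow> u \<in> insert v (set p) \<and>
      (\<forall>i. (i < length p \<longrightarrow> p ! i = u \<longrightarrow> u \<le> v) \<and>
        (\<forall>j. i < j \<longrightarrow> j < length p \<longrightarrow> p ! i = u \<longrightarrow> u \<le> p ! j))"
    unfolding active_def split by (auto simp: nth_append)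
  also have "\<dots> \<longleftrightarrow> u \<in> insert v (set p) \<and> (u \<in> set p \<longrightarrow> u \<in> active p \<and> u \<le> v)"
  proof -
    have "u \<in> set p" if "i < j" "j < length p" "p ! i = u" for i j
      using that by auto
    then show ?thesis unfolding active_def in_set_conv_nth by blast
  qed
  also have "\<dots> \<longleftrightarrow> u \<in> {u \<in> active p. u \<le> v} \<union> (if v \<in> set p then {} else {v})"
    using active_subset[of p] by auto
  finally show "u \<in> active (p @ [v])
      \<longleftrightarrow> u \<in> {u \<in> active p. u \<le> v} \<union> (if v \<in> set p then {} else {v})" .
qed

lemma active_snoc_new:
  assumes "\<And>u. u \<in> set p \<Longrightarrow> u < v"
  shows "active (p @ [v]) = insert v (active p)"
  using assms active_subset[of p] by (auto simp: active_snoc less_imp_le)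

text \<open>After a repeat, the number of active values is the rank of \<open>v\<close> among the
  old ones. This is the non-rising step of the walk.\<close>

lemma active_snoc_old:
  assumes "v \<in> active p"
  shows "active (p @ [v]) = {u \<in> active p. u \<le> v}"
  using assms active_subset[of p] by (auto simp: active_snoc)

section \<open>Restricted growth of 101-avoiding ascent sequences\<close>

definition ascent101 :: "nat list \<Rightarrow> bool" where
  "ascent101 xs \<longleftrightarrow> ascent_sequence xs \<and> avoids xs [1, 0, 1]"

lemma ascent101_nonempty: "ascent101 p \<Longrightarrow> p \<noteq> []"
  by (auto simp: ascent101_def ascent_sequence_def)

lemma ascent101_singleton [simp]: "ascent101 [v] \<longleftrightarrow> v = 0"
  by (auto simp: ascent101_def ascent_sequence_singleton avoids_101_iff)

lemma ascent101_snoc: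
  assumes "p \<noteq> []"
  shows "ascent101 (p @ [v]) \<longleftrightarrow>
    ascent101 p \<and> v \<le> asc p + 1 \<and> (v \<in> set p \<longrightarrow> v \<in> active p)"
  using assms by (auto simp: ascent101_def ascent_sequence_snoc avoids_101_snoc)

text \<open>The restricted growth property: an ascent can only go up to a new maximum, since a smaller
  active value never exceeds the last entry.\<close>

lemma ascent101_set: "ascent101 p \<Longrightarrow> set p = {..asc p}"
proof (induction p rule: rev_induct)
  case (snoc v p)
  show ?case
  proof (cases "p = []")
    case False
    have IH: "set p = {..asc p}" and v: "v \<le> asc p + 1" "v \<in> set p \<longrightarrow> v \<in> active p"
      using snoc False by (auto simp: ascent101_snoc)
    show ?thesis
    proof (cases "v \<in> set p")
      case True
      then have "v \<le> last p" using v active_le_last by blast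
      then show ?thesis using True IH False by (auto simp: asc_snoc)
    next
      case new: False
      then have "v = asc p + 1" using v IH by auto
      moreover have "last p < v" using \<open>v = asc p + 1\<close> IH last_in_set[OF False] by auto
      ultimately show ?thesis using IH False by (auto simp: asc_snoc)
    qed
  qed (use snoc.prems in auto)
qed (simp add: ascent101_def ascent_sequence_def)

text \<open>Since \<open>set p\<close> is \<open>{..asc p}\<close>, the bound
  \<open>asc p + 1\<close> admits a single value outside it.\<close>

lemma ascent101_snoc_iff:
  assumes "ascent101 p"
  shows "ascent101 (p @ [v]) \<longleftrightarrow> v = asc p + 1 \<or> v \<in> active p"
  using assms ascent101_set[OF assms] active_subset[of p]
  by (auto simp: ascent101_snoc ascent101_nonempty)

lemma ascent101_appendD:
  assumes "ascent101 (p @ ys)" "p \<noteq> []"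
  shows "ascent101 p"
  using assms
proof (induction ys rule: rev_induct)
  case (snoc v ys)
  then show ?case using ascent101_snoc[of "p @ ys" v] by simp
qed simp

section \<open>Equivalence of avoiding 101 and avoiding 0101\<close>

text \<open>By the growth property, the 0 of an occurrence of 101 already appears before its first 1.\<close>

lemma ascent_sequence_avoids_0101_imp_101:
  "ascent_sequence xs \<Longrightarrow> avoids xs [0, 1, 0, 1] \<Longrightarrow> avoids xs [1, 0, 1]"
proof (induction xs rule: rev_induct)
  case (snoc v p)
  show ?case
  proof (cases "p = []")
    case False
    have "avoids p [0, 1, 0, 1]"
      unfolding avoids_0101_iff
    proof (intro allI impI)
      fix h i j k assume "h < i" "i < j" "j < k" "k < length p" "p ! h < p ! i" "p ! j = p ! h"
      then show "p ! k \<noteq> p ! i"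
        using snoc.prems(2)[unfolded avoids_0101_iff, rule_format, of h i j k]
        by (simp add: nth_append)
    qed
    moreover have "ascent_sequence p" using snoc.prems False by (simp add: ascent_sequence_snoc)
    ultimately have p: "ascent101 p" using snoc.IH by (simp add: ascent101_def)
    have "v \<le> p ! j" if ij: "i < j" "j < length p" "p ! i = v" for i j
    proof (rule ccontr)
      assume less: "\<not> v \<le> p ! j"
      have "p ! 0 = 0" using p by (simp add: ascent101_def ascent_sequence_def)
      then have "i \<noteq> 0" using less ij by (intro notI) simp
      then have "take i p \<noteq> []" using False by simp
      then have "ascent101 (take i p)"
        using p ascent101_appendD[of "take i p" "drop i p"] by simp
      then have "set (take i p) = {..asc (take i p)}" by (rule ascent101_set)
      moreover have "p ! i \<le> asc (take i p) + 1"
        using p \<open>i \<noteq> 0\<close> ij(1,2) by (simp add: ascent101_def ascent_sequence_def)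
      ultimately have "p ! j \<in> set (take i p)" using less ij by auto
      then obtain h where h: "h < i" "p ! h = p ! j" using ij by (auto simp: in_set_conv_nth)
      show False
        using snoc.prems(2)[unfolded avoids_0101_iff, rule_format, of h i j "length p"] h ij less
        by (simp add: nth_append)
    qed
    then show ?thesis using p by (auto simp: avoids_101_snoc ascent101_def active_def)
  qed (simp add: avoids_101_iff)
qed (simp add: avoids_101_iff)

text \<open>Deleting the leading 0 from an occurrence of 0101 leaves one of 101.\<close>

lemma avoids_101_imp_0101: "avoids xs [1, 0, 1] \<Longrightarrow> avoids xs [0, 1, 0, 1]"
  unfolding avoids_101_iff avoids_0101_iff by metis

section \<open>Closed form for the number of walks\<close>

text \<open>The number of walks with \<open>n\<close> steps, of which \<open>k\<close> are up steps, that start at height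
  \<open>g\<close>, stay nonnegative, and move at each step either up by one or to any height that is
  at most the current one.\<close>

fun walks :: "nat \<Rightarrow> nat \<Rightarrow> nat \<Rightarrow> int" where
  "walks n g 0 = int ((n + g) choose g)"
| "walks n g (Suc k) = int (n choose Suc k) * int ((n + g) choose (g + Suc k))
     - int (n choose k) * int ((n + g) choose Suc (g + Suc k))"

lemma walks_0: "walks 0 g k = (if k = 0 then 1 else 0)"
  by (cases k) (auto simp: binomial_eq_0)

text \<open>Without up steps, the first step leads to some height \<open>j\<close> \<le>
  \<open>g\<close>; for the closed form this is the hockey-stick identity.\<close>

lemma walks_Suc_0: "walks (Suc n) g 0 = (\<Sum>j\<le>g. walks n j 0)"
  by (induction g) auto

text \<open>The first step either goes up, using one up step, or leads to some height
  \<open>j\<close> \<le> \<open>g\<close>. Induction on \<open>g\<close> leaves only the difference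
  of two consecutive instances, which follows from Pascal's rule.\<close>

lemma walks_Suc_Suc: "walks (Suc n) g (Suc k) = walks n (Suc g) k + (\<Sum>j\<le>g. walks n j (Suc k))"
proof (induction g)
  case 0
  show ?case by (cases k) (auto simp: algebra_simps)
next
  case (Suc g)
  have "walks (Suc n) (Suc g) (Suc k)
      = walks (Suc n) g (Suc k) + walks n (Suc (Suc g)) k - walks n (Suc g) k + walks n (Suc g) (Suc k)"
    \<comment> \<open>The split is due to the separate clause of \<open>walks\<close> for no up
      steps, where the subtracted product is absent.\<close>
    by (cases k) (auto simp: algebra_simps)
  then show ?case using Suc by simp
qed

text \<open>Ranks counted from 0 take each value below \<open>card S\<close> once; removing the
  maximum leaves the other ranks unchanged. This turns a sum over repeated active values into a sum
  over heights.\<close>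

lemma sum_rank:
  fixes S :: "nat set" and f :: "nat \<Rightarrow> int"
  assumes "finite S"
  shows "(\<Sum>v\<in>S. f (card {u \<in> S. u \<le> v} - 1)) = (\<Sum>j<card S. f j)"
  using assms
proof (induction S rule: finite_linorder_max_induct)
  case (insert b A)
  have "b \<notin> A" using insert by auto
  have "{u \<in> insert b A. u \<le> b} = insert b A" using insert.hyps(2) by (auto intro: less_imp_le)
  moreover have "{u \<in> insert b A. u \<le> v} = {u \<in> A. u \<le> v}" if "v \<in> A" for v
    using insert.hyps(2) that by fastforce
  ultimately show ?case using insert \<open>b \<notin> A\<close> by simp
qed simp

section \<open>Counting the extensions of a prefix\<close>

text \<open>Only the suffix is stored, so that the next entry is its first letter; \<open>a\<close>
  counts the ascents of the whole word, including those in \<open>p\<close> and at the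
  junction.\<close>

definition extensions :: "nat list \<Rightarrow> nat \<Rightarrow> nat \<Rightarrow> nat list set" where
  "extensions p n a = {ys. length ys = n \<and> ascent101 (p @ ys) \<and> asc (p @ ys) = a}"

lemma extensions_0: "ascent101 p \<Longrightarrow> extensions p 0 a = (if asc p = a then {[]} else {})"
  by (auto simp: extensions_def)

lemma extensions_Suc:
  assumes "ascent101 p"
  shows "extensions p (Suc n) a
    = (\<Union>v\<in>insert (asc p + 1) (active p). (#) v ` extensions (p @ [v]) n a)" (is "?L = ?R")
proof
  show "?L \<subseteq> ?R"
  proof
    fix zs assume "zs \<in> ?L"
    then obtain v ys where zs: "zs = v # ys" "length ys = n" "ascent101 ((p @ [v]) @ ys)"
      "asc ((p @ [v]) @ ys) = a"
      by (auto simp: extensions_def length_Suc_conv)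
    then have "ascent101 (p @ [v])" using ascent101_appendD[of "p @ [v]" ys] by simp
    then have "v \<in> insert (asc p + 1) (active p)" using ascent101_snoc_iff[OF assms] by auto
    moreover have "ys \<in> extensions (p @ [v]) n a" using zs by (simp add: extensions_def)
    ultimately show "zs \<in> ?R" using zs(1) by blast
  qed
qed (auto simp: extensions_def)

text \<open>The height of a walk is the number of active values, minus one.\<close>

lemma card_extensions:
  "ascent101 p \<Longrightarrow> finite (extensions p n (asc p + k)) \<and>
    int (card (extensions p n (asc p + k))) = walks n (card (active p) - 1) k"
proof (induction n arbitrary: p k)
  case 0
  then show ?case by (auto simp: extensions_0 walks_0)
next
  case (Suc n)
  let ?g = "card (active p) - 1" and ?a = "asc p + k" and ?m = "asc p + 1"
  have p: "p \<noteq> []" using Suc.prems by (rule ascent101_nonempty)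
  \<comment> \<open>The last entry is active, so the truncated subtraction in \<open>?g\<close> is
    exact.\<close>
  have act0: "last p \<in> active p"
    using Suc.prems p last_in_active by (simp add: ascent101_def)
  then have g: "card (active p) = Suc ?g"
    using card_gt_0_iff[of "active p"] by auto
  have m: "?m \<notin> active p" "\<And>u. u \<in> set p \<Longrightarrow> u < ?m"
    using ascent101_set[OF Suc.prems] active_subset[of p] by auto
  \<comment> \<open>An active value never exceeds the last entry, so repeating it makes no ascent
    and leaves \<open>k\<close> unchanged.\<close>
  have old: "finite (extensions (p @ [v]) n ?a) \<and>
      int (card (extensions (p @ [v]) n ?a)) = walks n (card {u \<in> active p. u \<le> v} - 1) k"
    if v: "v \<in> active p" for v
  proof -
    have "ascent101 (p @ [v])" using v ascent101_snoc_iff[OF Suc.prems] by simp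
    moreover have "asc (p @ [v]) = asc p" using active_le_last[OF v] p by (simp add: asc_snoc)
    ultimately show ?thesis using Suc.IH[of "p @ [v]" k] by (simp add: active_snoc_old[OF v])
  qed
  \<comment> \<open>A new maximum makes one of the \<open>k\<close> remaining ascents and raises the
    height by one.\<close>
  have new: "finite (extensions (p @ [?m]) n ?a) \<and> int (card (extensions (p @ [?m]) n ?a))
      = (case k of 0 \<Rightarrow> 0 | Suc k' \<Rightarrow> walks n (Suc ?g) k')"
  proof -
    have P: "ascent101 (p @ [?m])" using ascent101_snoc_iff[OF Suc.prems] by simp
    have asc: "asc (p @ [?m]) = asc p + 1"
      using m(2)[OF last_in_set[OF p]] p by (simp add: asc_snoc)
    show ?thesis
    proof (cases k)
      case 0
      \<comment> \<open>Appending never lowers the number of ascents, so the ascent just made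
        already exceeds the prescribed total.\<close>
      have "asc ((p @ [?m]) @ ys) \<noteq> asc p" for ys
        using asc_append_ge[of "p @ [?m]" ys] asc by simp
      then have "extensions (p @ [?m]) n ?a = {}" using 0 by (simp add: extensions_def)
      then show ?thesis using 0 by simp
    next
      case (Suc k')
      have "card (active (p @ [?m])) = Suc (Suc ?g)"
        using active_snoc_new[OF m(2)] m(1) g by simp
      then show ?thesis using Suc.IH[OF P, of k'] Suc asc by (simp add: One_nat_def)
    qed
  qed
  have fin: "finite (extensions p (Suc n) ?a)"
    using extensions_Suc[OF Suc.prems] old new by simp
  have "card (extensions p (Suc n) ?a)
      = (\<Sum>v\<in>insert ?m (active p). card ((#) v ` extensions (p @ [v]) n ?a))"
    unfolding extensions_Suc[OF Suc.prems] using old new by (intro card_UN_disjoint) auto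
  also have "\<dots> = (\<Sum>v\<in>insert ?m (active p). card (extensions (p @ [v]) n ?a))"
    by (intro sum.cong refl card_image) simp
  finally have "int (card (extensions p (Suc n) ?a))
      = int (card (extensions (p @ [?m]) n ?a)) + (\<Sum>v\<in>active p. int (card (extensions (p @ [v]) n ?a)))"
    using m(1) by simp
  also have "(\<Sum>v\<in>active p. int (card (extensions (p @ [v]) n ?a)))
      = (\<Sum>v\<in>active p. walks n (card {u \<in> active p. u \<le> v} - 1) k)"
    using old by (intro sum.cong) auto
  also have "\<dots> = (\<Sum>j\<le>?g. walks n j k)"
    using sum_rank[of "active p" "\<lambda>j. walks n j k"] lessThan_Suc_atMost[of ?g] g by simp
  also have "int (card (extensions (p @ [?m]) n ?a)) + (\<Sum>j\<le>?g. walks n j k) = walks (Suc n) ?g k"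
    using new by (cases k) (simp_all add: walks_Suc_0 walks_Suc_Suc del: walks.simps)
  finally show ?case using fin by simp
qed

section \<open>Narayana and Catalan identities\<close>

text \<open>At height 0 and for positive \<open>k\<close> the closed form is a 2-by-2 determinant of
  binomial coefficients, \<open>a * a - b * c\<close>; absorption turns it into a product.\<close>

lemma walks_eq_narayana: "real_of_int (walks n 0 k) = narayana (Suc n) (Suc k)"
proof -
  have absorb: "real (Suc j) * real (Suc n choose Suc j) = real (Suc n) * real (n choose j)" for j
    using Suc_times_binomial[of j n] by (metis of_nat_mult)
  have nar: "narayana (Suc n) (Suc k) = real (n choose k) * real (Suc n choose k) / real (Suc k)"
  proof -
    have "real (Suc n choose Suc k) = real (Suc n) * real (n choose k) / real (Suc k)"
      using absorb[of k] by (simp only: eq_divide_eq) (simp add: mult.commute)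
    then show ?thesis by (simp only: narayana_def) (simp del: binomial_Suc_Suc)
  qed
  show ?thesis
  proof (cases k)
    case 0
    then show ?thesis using nar by simp
  next
    case (Suc j)
    define a b c where "a = real (n choose Suc j)" and "b = real (n choose j)"
      and "c = real (n choose Suc (Suc j))"
    have 1: "(real j + 1) * (a + b) = (real n + 1) * b"
      using absorb[of j] by (simp add: a_def b_def algebra_simps)
    have 2: "(real j + 2) * (a + c) = (real n + 1) * a"
      using absorb[of "Suc j"] by (simp add: a_def c_def algebra_simps)
    \<comment> \<open>This eliminates \<open>n\<close>: \<open>a\<close> times the first identity
      and \<open>b\<close> times the second share the right-hand side
      \<open>(n + 1) * a * b\<close>.\<close>
    have "(real j + 2) * (a * a - b * c) = a * (a + b)"
      using 1 2 by algebra
    then show ?thesis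
      unfolding nar using Suc by (simp add: a_def b_def c_def field_simps)
  qed
qed

lemma sum_narayana:
  assumes "n \<ge> 1"
  shows "(\<Sum>k<n. narayana n (k + 1)) = catalan n"
proof -
  obtain m where n: "n = Suc m" using assms by (cases n) auto
  \<comment> \<open>Reflecting \<open>n choose (k + 1)\<close> makes the lower indices add up to
    \<open>m\<close>, as Vandermonde's identity requires.\<close>
  have "(\<Sum>k<n. (n choose (k + 1)) * (n choose k)) = (\<Sum>k\<le>m. (n choose k) * (n choose (m - k)))"
  proof (rule sum.cong)
    fix k assume "k \<in> {..m}"
    then show "(n choose (k + 1)) * (n choose k) = (n choose k) * (n choose (m - k))"
      using binomial_symmetric[of "k + 1" n] n by (simp add: mult.commute)
  qed (use n in auto)
  also have "\<dots> = (2 * n) choose m" by (simp add: vandermonde mult_2)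
  finally have "(\<Sum>k<n. narayana n (k + 1)) = real ((2 * n) choose m) / real n"
    unfolding narayana_def
    by (simp add: flip: of_nat_mult of_nat_sum sum_divide_distrib)
  also have "\<dots> = catalan n"
  proof -
    \<comment> \<open>Absorption moves the lower index from \<open>m\<close>, which is
      \<open>n - 1\<close>, to the central one.\<close>
    have "n * ((2 * n) choose n) = (n + 1) * ((2 * n) choose m)"
    proof -
      have "Suc m * ((2 * n) choose Suc m) = (2 * n - m) * ((2 * n) choose m)"
        by (simp only: binomial_absorption binomial_absorb_comp)
      moreover have "Suc m = n" "2 * n - m = n + 1" using n by simp_all
      ultimately show ?thesis by (simp only:)
    qed
    then have "real n * real ((2 * n) choose n) = real (n + 1) * real ((2 * n) choose m)"
      by (metis of_nat_mult)
    then show ?thesis using assms by (simp add: catalan_def frac_eq_eq mult.commute)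
  qed
  finally show ?thesis .
qed

section \<open>Enumeration by length and number of ascents\<close>

text \<open>Every ascent sequence starts with 0, so these are the extensions of \<open>[0]\<close>
  by \<open>n - 1\<close> entries. As \<open>[0]\<close> has no ascents and one active value, the
  walk starts at height 0.\<close>

lemma ascent101_asc_eq:
  assumes "n \<ge> 1"
  shows "finite {xs. ascent101 xs \<and> length xs = n \<and> asc xs = k}" (is "finite ?S")
    and "real (card {xs. ascent101 xs \<and> length xs = n \<and> asc xs = k}) = narayana n (k + 1)"
proof -
  obtain m where n: "n = Suc m" using assms by (cases n) auto
  have S: "?S = (#) 0 ` extensions [0] m k"
  proof (intro equalityI subsetI)
    fix xs assume xs: "xs \<in> ?S"
    then obtain ys where "xs = 0 # ys"
      using n by (cases xs) (auto simp: ascent101_def ascent_sequence_def)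
    then show "xs \<in> (#) 0 ` extensions [0] m k" using xs n by (auto simp: extensions_def)
  qed (auto simp: extensions_def n)
  have ext: "finite (extensions [0] m k)" "int (card (extensions [0] m k)) = walks m 0 k"
    using card_extensions[of "[0]" m k] by simp_all
  show "finite ?S" using S ext by simp
  have "int (card ?S) = walks m 0 k" using S ext by (simp add: card_image)
  then have "real (card ?S) = real_of_int (walks m 0 k)" by (metis of_int_of_nat_eq)
  then show "real (card ?S) = narayana n (k + 1)" using n walks_eq_narayana by (simp add: One_nat_def)
qed

lemma ascent101_count:
  assumes "n \<ge> 1"
  shows "real (card {xs. ascent101 xs \<and> length xs = n}) = catalan n"
proof -
  have "{xs. ascent101 xs \<and> length xs = n}
      = (\<Union>k<n. {xs. ascent101 xs \<and> length xs = n \<and> asc xs = k})"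
    using asc_less_length ascent101_nonempty by blast
  also have "card \<dots> = (\<Sum>k<n. card {xs. ascent101 xs \<and> length xs = n \<and> asc xs = k})"
    using ascent101_asc_eq(1)[OF assms] by (intro card_UN_disjoint) auto
  finally show ?thesis
    using ascent101_asc_eq(2)[OF assms] sum_narayana[OF assms] by simp
qed

theorem theorem2p5:
  shows "(\<forall>xs. ascent_sequence xs \<longrightarrow> (avoids xs [1, 0, 1] \<longleftrightarrow> avoids xs [0, 1, 0, 1])) \<and>
    (\<forall>n\<ge>1. real (card {xs. ascent_sequence xs \<and> length xs = n \<and> avoids xs [1, 0, 1]})
              = catalan n) \<and>
    (\<forall>n\<ge>1. \<forall>k\<le>n - 1.
       real (card {xs. ascent_sequence xs \<and> length xs = n \<and> avoids xs [1, 0, 1] \<and> asc xs = k})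
         = narayana n (k + 1))"
proof (intro conjI allI impI)
  fix xs assume "ascent_sequence xs"
  then show "avoids xs [1, 0, 1] \<longleftrightarrow> avoids xs [0, 1, 0, 1]"
    using ascent_sequence_avoids_0101_imp_101 avoids_101_imp_0101 by blast
next
  fix n :: nat assume "n \<ge> 1"
  then show "real (card {xs. ascent_sequence xs \<and> length xs = n \<and> avoids xs [1, 0, 1]}) = catalan n"
    using ascent101_count[of n] by (simp add: ascent101_def conj_ac)
next
  fix n k :: nat assume "n \<ge> 1"
  then show "real (card {xs. ascent_sequence xs \<and> length xs = n \<and> avoids xs [1, 0, 1] \<and> asc xs = k})
      = narayana n (k + 1)"
    using ascent101_asc_eq(2)[of n k] by (simp add: ascent101_def conj_ac)
qed

end
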